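(* Let $R:X\times X\to X\times X$ be a solution on a set $X$ such that $\pi_1\circ R:X\times X\to X$ is surjective. Then: (1) There exist two non-empty sets $A$ and $B$, a map $\omega:B\to B$ and an isomorphism of solutions $(X,R)\cong(A\times B,R_\omega)$, where $R_\omega:(A\times B)^2\to(A\times B)^2$ is the solution on $A\times B$ given for all $a_1,a_2\in A$ and $b_1,b_2\in B$ by $$R_\omega\bigl((a_1,b_1),(a_2,b_2)\bigr)=\bigl((a_1,b_2),(a_2,\omega(b_1))\bigr).$$ (2) Let $(A\times B,R_\omega)$ and $(C\times D,R_{\omega'})$ be two solutions of the form above (with $\omega:B\to B$ and $\omega':D\to D$ maps). Then there exists a bijection between the set of all isomorphisms of solutions $(A\times B,R_\omega)\cong(C\times D,R_{\omega'})$ and the set of all pairs $(\sigma_1,\sigma_2)$ consisting of two bijections $\sigma_1:A\to C$ and $\sigma_2:B\to D$ such that $\omega'=\sigma_2\circ\omega\circ\sigma_2^{-1}$. (3) There exist isomorphisms of groups $$\mathrm{Aut}(X,R)\cong\mathrm{Aut}(A\times B,R_\omega)\cong\Sigma_A\times\mathrm{Aut}(\omega),$$ where $A,B,\omega$ are as in (1).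
   Context: All sets are non-empty. $\Sigma_A$ is the group of all permutations of $A$; $\pi_1:X\times X\to X$ is the first projection. For a set $X$ let $\tau_X(x,y)=(y,x)$ be the flip map on $X\times X$. For a map $R:X\times X\to X\times X$ put, as maps $X^3\to X^3$, $R^{12}=R\times \mathrm{Id}_X$, $R^{23}=\mathrm{Id}_X\times R$, $R^{13}=(\mathrm{Id}_X\times\tau_X)\circ R^{12}\circ(\mathrm{Id}_X\times\tau_X)$. $R$ is called a solution on $X$ (of the set-theoretic Frobenius-Separability equation) if $R^{12}R^{23}=R^{23}R^{13}=R^{13}R^{12}$. An isomorphism of solutions $(X,R)\to(X',R')$ is a bijection $\sigma:X\to X'$ with $(\sigma\times\sigma)\circ R=R'\circ(\sigma\times\sigma)$; $\mathrm{Aut}(X,R)$ is the group of automorphisms. For $\omega:B\to B$, $\mathrm{Aut}(\omega)=\{\sigma\in\Sigma_B:\sigma\circ\omega=\omega\circ\sigma\}$. *)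

theory Defs
  imports "HOL-Algebra.Bij"
begin

definition flip :: "'a \<times> 'a \<Rightarrow> 'a \<times> 'a" where
  "flip = (\<lambda>(x, y). (y, x))"

text \<open>Triples are nested to the right, so \<open>X\<^sup>3\<close> is \<open>X \<times> (X \<times> X)\<close>.\<close>

definition R12 :: "('a \<times> 'a \<Rightarrow> 'a \<times> 'a) \<Rightarrow> 'a \<times> 'a \<times> 'a \<Rightarrow> 'a \<times> 'a \<times> 'a" where
  "R12 R = (\<lambda>(x, y, z). let (u, v) = R (x, y) in (u, v, z))"

definition R23 :: "('a \<times> 'a \<Rightarrow> 'a \<times> 'a) \<Rightarrow> 'a \<times> 'a \<times> 'a \<Rightarrow> 'a \<times> 'a \<times> 'a" where
  "R23 R = map_prod id R"

definition R13 :: "('a \<times> 'a \<Rightarrow> 'a \<times> 'a) \<Rightarrow> 'a \<times> 'a \<times> 'a \<Rightarrow> 'a \<times> 'a \<times> 'a" where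
  "R13 R = map_prod id flip \<circ> R12 R \<circ> map_prod id flip"

text \<open>Only the restriction of \<open>R\<close> to \<open>X \<times> X\<close> matters.\<close>

definition fs_solution :: "'a set \<Rightarrow> ('a \<times> 'a \<Rightarrow> 'a \<times> 'a) \<Rightarrow> bool" where
  "fs_solution X R \<longleftrightarrow>
     R \<in> X \<times> X \<rightarrow> X \<times> X \<and>
     (\<forall>t \<in> X \<times> X \<times> X.
        (R12 R \<circ> R23 R) t = (R23 R \<circ> R13 R) t \<and>
        (R23 R \<circ> R13 R) t = (R13 R \<circ> R12 R) t)"

text \<open>Maps out of a set \<open>X\<close> are represented by their unique representative in
  \<open>extensional X\<close>, as in \<^const>\<open>Bij\<close>, so that sets of bijections have the intended cardinality.\<close>

definition bijections :: "'a set \<Rightarrow> 'b set \<Rightarrow> ('a \<Rightarrow> 'b) set" where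
  "bijections X Y = extensional X \<inter> {f. bij_betw f X Y}"

definition sol_isos ::
    "'a set \<Rightarrow> ('a \<times> 'a \<Rightarrow> 'a \<times> 'a) \<Rightarrow> 'b set \<Rightarrow> ('b \<times> 'b \<Rightarrow> 'b \<times> 'b) \<Rightarrow> ('a \<Rightarrow> 'b) set" where
  "sol_isos X R Y S =
     {\<sigma> \<in> bijections X Y. \<forall>p \<in> X \<times> X. (map_prod \<sigma> \<sigma> \<circ> R) p = (S \<circ> map_prod \<sigma> \<sigma>) p}"

definition sol_Aut :: "'a set \<Rightarrow> ('a \<times> 'a \<Rightarrow> 'a \<times> 'a) \<Rightarrow> ('a \<Rightarrow> 'a) monoid" where
  "sol_Aut X R = (BijGroup X)\<lparr>carrier := sol_isos X R X R\<rparr>"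

definition map_Aut :: "'b set \<Rightarrow> ('b \<Rightarrow> 'b) \<Rightarrow> ('b \<Rightarrow> 'b) monoid" where
  "map_Aut B \<omega> = (BijGroup B)\<lparr>carrier := {\<sigma> \<in> Bij B. \<forall>b \<in> B. (\<sigma> \<circ> \<omega>) b = (\<omega> \<circ> \<sigma>) b}\<rparr>"

definition R_omega :: "('b \<Rightarrow> 'b) \<Rightarrow> ('a \<times> 'b) \<times> ('a \<times> 'b) \<Rightarrow> ('a \<times> 'b) \<times> ('a \<times> 'b)" where
  "R_omega \<omega> = (\<lambda>((a1, b1), (a2, b2)). ((a1, b2), (a2, \<omega> b1)))"

lemma bijections_self: "bijections X X = Bij X"
  by (simp add: bijections_def Bij_def)

lemma fs_solution_R_omega:
  assumes "\<omega> \<in> B \<rightarrow> B"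
  shows "fs_solution (A \<times> B) (R_omega \<omega>)"
  using assms by (auto simp: fs_solution_def R12_def R23_def R13_def flip_def R_omega_def)

lemma subgroup_BijGroupI:
  assumes "C \<subseteq> Bij X"
    and "(\<lambda>x\<in>X. x) \<in> C"
    and "\<And>f g. f \<in> C \<Longrightarrow> g \<in> C \<Longrightarrow> compose X f g \<in> C"
    and "\<And>f. f \<in> C \<Longrightarrow> (\<lambda>x\<in>X. inv_into X f x) \<in> C"
  shows "subgroup C (BijGroup X)"
proof (rule group.subgroupI [OF group_BijGroup])
  show "C \<subseteq> carrier (BijGroup X)" using assms(1) by (simp add: BijGroup_def)
  show "C \<noteq> {}" using assms(2) by blast
  show "inv\<^bsub>BijGroup X\<^esub> f \<in> C" if "f \<in> C" for f
    using that assms(1,4) by (metis inv_BijGroup subsetD)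
  show "f \<otimes>\<^bsub>BijGroup X\<^esub> g \<in> C" if "f \<in> C" "g \<in> C" for f g
    using that assms(1,3) by (auto simp: BijGroup_def restrict_def subset_iff)
qed

lemma subgroup_map_Aut:
  assumes w: "\<omega> \<in> B \<rightarrow> B"
  shows "subgroup (carrier (map_Aut B \<omega>)) (BijGroup B)"
proof (rule subgroup_BijGroupI)
  fix f assume f: "f \<in> carrier (map_Aut B \<omega>)"
  then have fB: "f \<in> Bij B" and c: "\<And>b. b \<in> B \<Longrightarrow> f (\<omega> b) = \<omega> (f b)"
    by (auto simp: map_Aut_def)
  have bij: "bij_betw f B B" using fB by (simp add: Bij_def)
  have "inv_into B f (\<omega> b) = \<omega> (inv_into B f b)" if b: "b \<in> B" for b
  proof -
    have i: "inv_into B f b \<in> B" using bij b by (simp add: bij_betw_def inv_into_into)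
    have "f (\<omega> (inv_into B f b)) = \<omega> b"
      using c [OF i] bij b by (simp add: bij_betw_inv_into_right)
    then show ?thesis using bij i w by (metis PiE bij_betw_inv_into_left)
  qed
  moreover have "inv_into B f b \<in> B" if "b \<in> B" for b
    using bij that by (simp add: bij_betw_def inv_into_into)
  ultimately show "(\<lambda>x\<in>B. inv_into B f x) \<in> carrier (map_Aut B \<omega>)"
    using w restrict_inv_into_Bij [OF fB] by (auto simp: map_Aut_def Pi_iff)
next
  fix f g assume fg: "f \<in> carrier (map_Aut B \<omega>)" "g \<in> carrier (map_Aut B \<omega>)"
  then have "f \<in> Bij B" and gB: "g \<in> Bij B" by (auto simp: map_Aut_def)
  then have "compose B f g \<in> Bij B" by (rule compose_Bij)
  moreover have "g \<in> B \<rightarrow> B" using gB by (rule Bij_imp_funcset)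
  ultimately show "compose B f g \<in> carrier (map_Aut B \<omega>)"
    using fg w by (auto simp: map_Aut_def compose_def Pi_iff)
qed (use w in \<open>auto simp: map_Aut_def id_Bij Pi_iff\<close>)

lemma subgroup_sol_Aut:
  assumes R: "R \<in> X \<times> X \<rightarrow> X \<times> X"
  shows "subgroup (carrier (sol_Aut X R)) (BijGroup X)"
proof (rule subgroup_BijGroupI)
  have R': "fst (R (x, y)) \<in> X" "snd (R (x, y)) \<in> X" if "x \<in> X" "y \<in> X" for x y
    using R that by (auto simp: Pi_iff mem_Times_iff)
  show "carrier (sol_Aut X R) \<subseteq> Bij X"
    by (auto simp: sol_Aut_def sol_isos_def bijections_self)
  show "(\<lambda>x\<in>X. x) \<in> carrier (sol_Aut X R)"
    using R' by (auto simp: sol_Aut_def sol_isos_def bijections_self id_Bij map_prod_def split_beta)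
  fix f assume f: "f \<in> carrier (sol_Aut X R)"
  then have fX: "f \<in> Bij X"
    and c: "\<And>x y. x \<in> X \<Longrightarrow> y \<in> X \<Longrightarrow> R (f x, f y) = (f (fst (R (x, y))), f (snd (R (x, y))))"
    by (auto simp: sol_Aut_def sol_isos_def bijections_self map_prod_def split_beta)
  have bij: "bij_betw f X X" using fX by (simp add: Bij_def)
  have i: "inv_into X f x \<in> X" "f (inv_into X f x) = x" if "x \<in> X" for x
    using bij that by (auto simp: bij_betw_def inv_into_into f_inv_into_f)
  have "R (inv_into X f x, inv_into X f y) =
      (inv_into X f (fst (R (x, y))), inv_into X f (snd (R (x, y))))" if "x \<in> X" "y \<in> X" for x y
    using c [OF i(1) i(1), OF that] i(2) that bij R' [OF i(1) i(1), OF that]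
    by (simp add: bij_betw_inv_into_left)
  then show "(\<lambda>x\<in>X. inv_into X f x) \<in> carrier (sol_Aut X R)"
    using R' i restrict_inv_into_Bij [OF fX]
    by (auto simp: sol_Aut_def sol_isos_def bijections_self map_prod_def split_beta)
  fix g assume g: "g \<in> carrier (sol_Aut X R)"
  then have gX: "g \<in> Bij X"
    and d: "\<And>x y. x \<in> X \<Longrightarrow> y \<in> X \<Longrightarrow> R (g x, g y) = (g (fst (R (x, y))), g (snd (R (x, y))))"
    by (auto simp: sol_Aut_def sol_isos_def bijections_self map_prod_def split_beta)
  have "g \<in> X \<rightarrow> X" using gX by (rule Bij_imp_funcset)
  then show "compose X f g \<in> carrier (sol_Aut X R)"
    using R' c d compose_Bij [OF fX gX]
    by (auto simp: sol_Aut_def sol_isos_def bijections_self map_prod_def split_beta compose_def Pi_iff)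
qed

lemma group_map_Aut: "\<omega> \<in> B \<rightarrow> B \<Longrightarrow> group (map_Aut B \<omega>)"
  using group.subgroup_imp_group [OF group_BijGroup subgroup_map_Aut] by (simp add: map_Aut_def)

lemma group_sol_Aut: "R \<in> X \<times> X \<rightarrow> X \<times> X \<Longrightarrow> group (sol_Aut X R)"
  using group.subgroup_imp_group [OF group_BijGroup subgroup_sol_Aut] by (simp add: sol_Aut_def)

end

theory Submission
  imports Defs
begin

text \<open>
  Write \<open>R (x, y) = (x \<cdot> y, x \<star> y)\<close>.  Compared coordinate by coordinate, the equation
  \<open>R\<^sup>1\<^sup>2 R\<^sup>2\<^sup>3 = R\<^sup>2\<^sup>3 R\<^sup>1\<^sup>3 = R\<^sup>1\<^sup>3 R\<^sup>1\<^sup>2\<close> says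
  \<open>x \<cdot> (y \<cdot> z) = x \<cdot> z = (x \<cdot> y) \<cdot> z\<close>, then \<open>x \<star> (y \<cdot> z) = y \<cdot> (x \<star> z) = x \<star> y\<close>, and finally
  \<open>y \<star> z = y \<star> (x \<star> z) = (x \<cdot> y) \<star> z\<close>.  The first line makes \<open>(X, \<cdot>)\<close> a semigroup with
  \<open>x \<cdot> y \<cdot> z = x \<cdot> z\<close>; as every element is a product, it is idempotent, that is, a rectangular band.
  So for any base point \<open>p\<close> the map \<open>x \<mapsto> (x \<cdot> p, p \<cdot> x)\<close> identifies \<open>X\<close> with \<open>(X \<cdot> p) \<times> (p \<cdot> X)\<close>,
  with inverse \<open>(a, b) \<mapsto> a \<cdot> b\<close>, and turns \<open>\<cdot>\<close> into \<open>(a\<^sub>1, b\<^sub>1) \<cdot> (a\<^sub>2, b\<^sub>2) = (a\<^sub>1, b\<^sub>2)\<close>.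
  In these coordinates the other equations leave \<open>x \<star> y\<close> no freedom except a self-map of the
  second factor: \<open>(x \<star> y) \<cdot> p = y \<cdot> p\<close> and \<open>p \<cdot> (x \<star> y) = (p \<cdot> x) \<star> p\<close>, so
  \<open>\<omega> b = b \<star> p\<close>.  This is \<open>surjective_solution_iso_R_omega\<close>.

  An isomorphism between two solutions \<open>R_omega \<omega>\<close> and \<open>R_omega \<omega>'\<close> preserves the band operation, hence
  must be a product of two bijections; compatibility with the second coordinate then says that
  the second of these intertwines \<open>\<omega>\<close> and \<open>\<omega>'\<close> (\<open>bij_betw_restricted_product\<close>).
  For automorphisms, forming products of maps is also multiplicative, which gives
  \<open>sol_Aut_R_omega_iso\<close>, and conjugation transports automorphism groups along an isomorphism
  (\<open>sol_Aut_iso_if_isomorphic\<close>).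
\<close>

section \<open>Solutions whose first component is surjective\<close>

text \<open>Four of the coordinate equations; the classification follows from these.\<close>

lemma fs_solution_components:
  assumes "fs_solution X R" "x \<in> X" "y \<in> X" "z \<in> X"
  shows "fst (R (x, fst (R (y, z)))) = fst (R (x, z))"
    and "fst (R (fst (R (x, y)), z)) = fst (R (x, z))"
    and "fst (R (y, snd (R (x, z)))) = snd (R (x, y))"
    and "snd (R (fst (R (x, y)), z)) = snd (R (y, z))"
proof -
  have "(R12 R \<circ> R23 R) (x, y, z) = (R23 R \<circ> R13 R) (x, y, z)"
    and "(R23 R \<circ> R13 R) (x, y, z) = (R13 R \<circ> R12 R) (x, y, z)"
    using assms unfolding fs_solution_def by blast+
  then show "fst (R (x, fst (R (y, z)))) = fst (R (x, z))"
    and "fst (R (fst (R (x, y)), z)) = fst (R (x, z))"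
    and "fst (R (y, snd (R (x, z)))) = snd (R (x, y))"
    and "snd (R (fst (R (x, y)), z)) = snd (R (y, z))"
    by (auto simp: R12_def R23_def R13_def flip_def split_beta Let_def prod_eq_iff)
qed

text \<open>
  The coordinates are \<open>x \<mapsto> (x \<cdot> p, p \<cdot> x)\<close> for a base point \<open>p\<close>.  Surjectivity of the first
  component enters only through idempotence: it is what makes \<open>x\<close> recoverable as
  \<open>(x \<cdot> p) \<cdot> (p \<cdot> x) = x \<cdot> x\<close>.
\<close>

lemma surjective_solution_iso_R_omega:
  fixes X :: "'x set"
  assumes "X \<noteq> {}" and sol: "fs_solution X R" and surj: "(fst \<circ> R) ` (X \<times> X) = X"
  obtains A B :: "'x set" and \<omega> \<phi>
  where "A \<noteq> {}" "B \<noteq> {}" "\<omega> \<in> B \<rightarrow> B" "\<phi> \<in> sol_isos X R (A \<times> B) (R_omega \<omega>)"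
proof -
  define m where "m x y = fst (R (x, y))" for x y
  define s where "s x y = snd (R (x, y))" for x y
  have R: "R (x, y) = (m x y, s x y)" for x y by (simp add: m_def s_def)
  have mX: "m x y \<in> X" and sX: "s x y \<in> X" if "x \<in> X" "y \<in> X" for x y
    using sol that by (auto simp: fs_solution_def m_def s_def Pi_iff mem_Times_iff)
  have m_right: "m x (m y z) = m x z" and m_left: "m (m x y) z = m x z"
    and ms: "m y (s x z) = s x y" and sm: "s (m x y) z = s y z"
    if "x \<in> X" "y \<in> X" "z \<in> X" for x y z
    using fs_solution_components [OF sol that] by (simp_all add: m_def s_def)
  have idem: "m x x = x" if "x \<in> X" for x
  proof -
    from that surj have "x \<in> (fst \<circ> R) ` (X \<times> X)" by simp
    then obtain u v where uv: "u \<in> X" "v \<in> X" "x = m u v" by (auto simp: m_def)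
    then show ?thesis by (simp add: m_left m_right mX)
  qed
  obtain p where p: "p \<in> X" using \<open>X \<noteq> {}\<close> by blast
  define A where "A = (\<lambda>x. m x p) ` X"
  define B where "B = m p ` X"
  define \<omega> where "\<omega> b = s b p" for b
  define \<phi> where "\<phi> = (\<lambda>x\<in>X. (m x p, m p x))"
  have "bij_betw \<phi> X (A \<times> B)"
  proof (rule bij_betw_byWitness [where f' = "\<lambda>(a, b). m a b"])
    show "\<forall>x\<in>X. (\<lambda>(a, b). m a b) (\<phi> x) = x"
      using p by (simp add: \<phi>_def m_left m_right mX idem)
    show "\<forall>q\<in>A \<times> B. \<phi> ((\<lambda>(a, b). m a b) q) = q"
      using p by (auto simp: \<phi>_def A_def B_def m_left m_right mX)
  qed (use p in \<open>auto simp: \<phi>_def A_def B_def mX\<close>)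
  moreover have "R_omega \<omega> (\<phi> x, \<phi> y) = map_prod \<phi> \<phi> (R (x, y))" if "x \<in> X" "y \<in> X" for x y
  proof -
    \<comment> \<open>Since \<open>x \<star> y = y \<cdot> (x \<star> p)\<close>, its first coordinate is that of \<open>y\<close>.\<close>
    have "m (s x y) p = m y p" using that p by (metis ms m_left sX)
    moreover have "m p (s x y) = s (m p x) p" using that p by (simp add: ms sm)
    ultimately show ?thesis
      using that p by (simp add: R R_omega_def \<phi>_def \<omega>_def m_left m_right mX sX)
  qed
  ultimately have "\<phi> \<in> sol_isos X R (A \<times> B) (R_omega \<omega>)"
    by (auto simp: sol_isos_def bijections_def \<phi>_def)
  moreover have "\<omega> \<in> B \<rightarrow> B"
  proof
    fix b assume "b \<in> B"
    then have "b \<in> X" using p by (auto simp: B_def mX)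
    \<comment> \<open>\<open>b \<star> p\<close> lies in \<open>p \<cdot> X\<close> because \<open>b \<star> p = p \<cdot> (b \<star> p)\<close>.\<close>
    then have "\<omega> b = m p (s b p)" "s b p \<in> X" using p by (simp_all add: \<omega>_def ms sX)
    then show "\<omega> b \<in> B" by (simp add: B_def)
  qed
  moreover have "A \<noteq> {}" "B \<noteq> {}" using p by (auto simp: A_def B_def)
  ultimately show thesis using that by blast
qed

section \<open>Isomorphisms between the solutions of a pair of maps\<close>

text \<open>
  For a bijection \<open>g\<close>, commuting with the two maps means \<open>\<omega>' = g \<circ> \<omega> \<circ> g\<inverse>\<close>.  In the form chosen
  here, which avoids the inverse, the case \<open>\<omega>' = \<omega>\<close> is the centralizer of \<open>\<omega>\<close> as it stands.
\<close>

definition intertwiners :: "'b set \<Rightarrow> ('b \<Rightarrow> 'b) \<Rightarrow> 'd set \<Rightarrow> ('d \<Rightarrow> 'd) \<Rightarrow> ('b \<Rightarrow> 'd) set" where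
  "intertwiners B \<omega> D \<omega>' = {g \<in> bijections B D. \<forall>b \<in> B. g (\<omega> b) = \<omega>' (g b)}"

lemma intertwiners_conjugation:
  assumes w: "\<omega> \<in> B \<rightarrow> B"
  shows "intertwiners B \<omega> D \<omega>' =
    {g \<in> bijections B D. \<forall>d \<in> D. \<omega>' d = (g \<circ> \<omega> \<circ> inv_into B g) d}"
proof -
  have "(\<forall>b \<in> B. g (\<omega> b) = \<omega>' (g b)) \<longleftrightarrow> (\<forall>d \<in> D. \<omega>' d = (g \<circ> \<omega> \<circ> inv_into B g) d)"
    if "g \<in> bijections B D" for g
  proof -
    from that have "inj_on g B" "D = g ` B" by (auto simp: bijections_def bij_betw_def)
    then show ?thesis by auto
  qed
  then show ?thesis unfolding intertwiners_def by blast
qed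

lemma carrier_map_Aut: "carrier (map_Aut B \<omega>) = intertwiners B \<omega> B \<omega>"
  by (simp add: map_Aut_def intertwiners_def bijections_self)

text \<open>
  The restriction is what makes a product of two maps a member of a set of isomorphisms, as these
  are extensional functions.
\<close>

definition restricted_product :: "'a set \<Rightarrow> 'b set \<Rightarrow> ('a \<Rightarrow> 'c) \<times> ('b \<Rightarrow> 'd) \<Rightarrow> 'a \<times> 'b \<Rightarrow> 'c \<times> 'd" where
  "restricted_product A B = (\<lambda>(f, g). restrict (map_prod f g) (A \<times> B))"

lemma restricted_product_apply:
  "a \<in> A \<Longrightarrow> b \<in> B \<Longrightarrow> restricted_product A B (f, g) (a, b) = (f a, g b)"
  by (simp add: restricted_product_def)

lemma restricted_product_bijections_iff:
  assumes "A \<noteq> {}" "B \<noteq> {}" "f \<in> extensional A" "g \<in> extensional B"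
  shows "restricted_product A B (f, g) \<in> bijections (A \<times> B) (C \<times> D) \<longleftrightarrow>
    f \<in> bijections A C \<and> g \<in> bijections B D"
proof -
  have "inj_on (map_prod f g) (A \<times> B) \<longleftrightarrow> inj_on f A \<and> inj_on g B"
    using assms(1,2) unfolding inj_on_def by auto
  moreover have "map_prod f g ` (A \<times> B) = f ` A \<times> g ` B" by auto
  moreover have "f ` A \<times> g ` B = C \<times> D \<longleftrightarrow> f ` A = C \<and> g ` B = D"
    using assms(1,2) by (auto simp: times_eq_iff)
  moreover have "bij_betw (restricted_product A B (f, g)) (A \<times> B) (C \<times> D) \<longleftrightarrow>
      bij_betw (map_prod f g) (A \<times> B) (C \<times> D)"
    by (rule bij_betw_cong) (auto simp: restricted_product_def)
  ultimately show ?thesis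
    using assms(3,4) by (auto simp: bijections_def bij_betw_def restricted_product_def)
qed

text \<open>
  \<open>R_omega \<omega>\<close> only permutes coordinates, except that it applies \<open>\<omega>\<close> to \<open>b\<^sub>1\<close>; a product map respects the
  permutation automatically, so the only condition left concerns \<open>\<omega>\<close>.
\<close>

lemma restricted_product_sol_isos_iff:
  assumes "A \<noteq> {}" "B \<noteq> {}" "\<omega> \<in> B \<rightarrow> B" "f \<in> extensional A" "g \<in> extensional B"
  shows "restricted_product A B (f, g) \<in> sol_isos (A \<times> B) (R_omega \<omega>) (C \<times> D) (R_omega \<omega>') \<longleftrightarrow>
    f \<in> bijections A C \<and> g \<in> intertwiners B \<omega> D \<omega>'"
proof -
  have "(\<forall>p \<in> (A \<times> B) \<times> (A \<times> B).
      (map_prod (restricted_product A B (f, g)) (restricted_product A B (f, g)) \<circ> R_omega \<omega>) p =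
      (R_omega \<omega>' \<circ> map_prod (restricted_product A B (f, g)) (restricted_product A B (f, g))) p)
    \<longleftrightarrow> (\<forall>b \<in> B. g (\<omega> b) = \<omega>' (g b))"
    using assms(1-3) by (auto simp: R_omega_def restricted_product_apply Pi_iff)
  then show ?thesis
    using restricted_product_bijections_iff [OF assms(1,2,4,5)]
    unfolding sol_isos_def intertwiners_def by auto
qed

text \<open>A factor can be recovered only at a point of the other one, so both sets must be inhabited.\<close>

lemma inj_on_restricted_product:
  fixes A :: "'a set" and B :: "'b set"
  assumes "A \<noteq> {}" "B \<noteq> {}"
  shows "inj_on (restricted_product A B)
    ((extensional A :: ('a \<Rightarrow> 'c) set) \<times> (extensional B :: ('b \<Rightarrow> 'd) set))"
proof (rule inj_onI, clarify)
  fix f f' :: "'a \<Rightarrow> 'c" and g g' :: "'b \<Rightarrow> 'd"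
  assume ext: "f \<in> extensional A" "f' \<in> extensional A" "g \<in> extensional B" "g' \<in> extensional B"
    and eq: "restricted_product A B (f, g) = restricted_product A B (f', g')"
  have "f a = f' a \<and> g b = g' b" if "a \<in> A" "b \<in> B" for a b
    using fun_cong [OF eq, of "(a, b)"] that by (simp add: restricted_product_apply)
  then show "f = f' \<and> g = g'" using assms ext by (blast intro: extensionalityI)
qed

text \<open>
  The first component of the isomorphism equation reads
  \<open>\<sigma> (a\<^sub>1, b\<^sub>2) = (fst (\<sigma> (a\<^sub>1, b\<^sub>1)), snd (\<sigma> (a\<^sub>2, b\<^sub>2)))\<close>.  So the first coordinate of \<open>\<sigma> (a, b)\<close>
  does not depend on \<open>b\<close>, nor the second one on \<open>a\<close>.
\<close>

lemma sol_iso_R_omega_splits: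
  assumes "A \<noteq> {}" "B \<noteq> {}" and \<sigma>: "\<sigma> \<in> sol_isos (A \<times> B) (R_omega \<omega>) (C \<times> D) (R_omega \<omega>')"
  obtains f g where "f \<in> extensional A" "g \<in> extensional B" "\<sigma> = restricted_product A B (f, g)"
proof -
  obtain a0 b0 where 0: "a0 \<in> A" "b0 \<in> B" using assms(1,2) by blast
  define f where "f = (\<lambda>a\<in>A. fst (\<sigma> (a, b0)))"
  define g where "g = (\<lambda>b\<in>B. snd (\<sigma> (a0, b)))"
  have "\<sigma> (a, b) = (f a, g b)" if "a \<in> A" "b \<in> B" for a b
  proof -
    have "(map_prod \<sigma> \<sigma> \<circ> R_omega \<omega>) ((a, b0), (a0, b)) =
        (R_omega \<omega>' \<circ> map_prod \<sigma> \<sigma>) ((a, b0), (a0, b))"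
      using \<sigma> 0 that unfolding sol_isos_def by blast
    then show ?thesis using that by (simp add: R_omega_def f_def g_def split_beta)
  qed
  moreover have "\<sigma> \<in> extensional (A \<times> B)" using \<sigma> by (simp add: sol_isos_def bijections_def)
  ultimately have "\<sigma> = restricted_product A B (f, g)"
    by (intro extensionalityI [where A = "A \<times> B"]) (auto simp: restricted_product_def)
  moreover have "f \<in> extensional A" "g \<in> extensional B" by (simp_all add: f_def g_def)
  ultimately show thesis using that by blast
qed

lemma bij_betw_restricted_product:
  assumes "A \<noteq> {}" "B \<noteq> {}" "\<omega> \<in> B \<rightarrow> B"
  shows "bij_betw (restricted_product A B) (bijections A C \<times> intertwiners B \<omega> D \<omega>')
    (sol_isos (A \<times> B) (R_omega \<omega>) (C \<times> D) (R_omega \<omega>'))"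
proof (rule bij_betw_imageI)
  have sub: "bijections A C \<times> intertwiners B \<omega> D \<omega>' \<subseteq> extensional A \<times> extensional B"
    by (auto simp: bijections_def intertwiners_def)
  show "inj_on (restricted_product A B) (bijections A C \<times> intertwiners B \<omega> D \<omega>')"
    using inj_on_restricted_product [OF assms(1,2)] sub by (rule inj_on_subset)
  show "restricted_product A B ` (bijections A C \<times> intertwiners B \<omega> D \<omega>') =
      sol_isos (A \<times> B) (R_omega \<omega>) (C \<times> D) (R_omega \<omega>')"
  proof (intro equalityI subsetI)
    fix \<sigma> assume "\<sigma> \<in> restricted_product A B ` (bijections A C \<times> intertwiners B \<omega> D \<omega>')"
    then show "\<sigma> \<in> sol_isos (A \<times> B) (R_omega \<omega>) (C \<times> D) (R_omega \<omega>')"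
      using sub restricted_product_sol_isos_iff [OF assms] by blast
  next
    fix \<sigma> assume \<sigma>: "\<sigma> \<in> sol_isos (A \<times> B) (R_omega \<omega>) (C \<times> D) (R_omega \<omega>')"
    then show "\<sigma> \<in> restricted_product A B ` (bijections A C \<times> intertwiners B \<omega> D \<omega>')"
      using sol_iso_R_omega_splits [OF assms(1,2) \<sigma>] restricted_product_sol_isos_iff [OF assms]
      by (metis SigmaI image_eqI)
  qed
qed

section \<open>Automorphism groups\<close>

lemma carrier_sol_Aut: "carrier (sol_Aut X R) = sol_isos X R X R"
  by (simp add: sol_Aut_def)

lemma mult_sol_Aut:
  assumes "f \<in> sol_isos X R X R" "g \<in> sol_isos X R X R"
  shows "f \<otimes>\<^bsub>sol_Aut X R\<^esub> g = compose X f g"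
  using assms by (simp add: sol_Aut_def BijGroup_def sol_isos_def bijections_self)

lemma sol_Aut_R_omega_iso:
  assumes "A \<noteq> {}" "B \<noteq> {}" "\<omega> \<in> B \<rightarrow> B"
  shows "sol_Aut (A \<times> B) (R_omega \<omega>) \<cong> BijGroup A \<times>\<times> map_Aut B \<omega>"
proof -
  let ?P = "BijGroup A \<times>\<times> map_Aut B \<omega>" and ?S = "sol_Aut (A \<times> B) (R_omega \<omega>)"
  have P: "carrier ?P = bijections A A \<times> intertwiners B \<omega> B \<omega>"
    by (simp add: carrier_map_Aut) (simp add: BijGroup_def bijections_self)
  have bij: "bij_betw (restricted_product A B) (carrier ?P) (carrier ?S)"
    using bij_betw_restricted_product [OF assms, of A B \<omega>] unfolding P carrier_sol_Aut .
  have "restricted_product A B \<in> hom ?P ?S"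
  proof (rule homI)
    show "restricted_product A B x \<in> carrier ?S" if "x \<in> carrier ?P" for x
      using bij that by (rule bij_betwE [rule_format])
    fix x y assume x: "x \<in> carrier ?P" and y: "y \<in> carrier ?P"
    obtain f g f' g' where xy: "x = (f, g)" "y = (f', g')" by (meson surj_pair)
    have B: "f \<in> Bij A" "f' \<in> Bij A" "g \<in> Bij B" "g' \<in> Bij B"
      using x y unfolding xy P by (auto simp: intertwiners_def bijections_self)
    then have "f' \<in> A \<rightarrow> A" "g' \<in> B \<rightarrow> B" by (auto dest: Bij_imp_funcset)
    then have "restricted_product A B (compose A f f', compose B g g') =
        compose (A \<times> B) (restricted_product A B (f, g)) (restricted_product A B (f', g'))"
      by (auto simp: fun_eq_iff restricted_product_def compose_def Pi_iff)
    moreover have "x \<otimes>\<^bsub>?P\<^esub> y = (compose A f f', compose B g g')"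
      using B by (simp add: xy map_Aut_def BijGroup_def)
    moreover have "restricted_product A B x \<in> carrier ?S" "restricted_product A B y \<in> carrier ?S"
      using bij x y by (auto dest: bij_betwE)
    then have "restricted_product A B x \<otimes>\<^bsub>?S\<^esub> restricted_product A B y =
        compose (A \<times> B) (restricted_product A B x) (restricted_product A B y)"
      by (intro mult_sol_Aut) (simp_all add: carrier_sol_Aut)
    ultimately show "restricted_product A B (x \<otimes>\<^bsub>?P\<^esub> y) =
        restricted_product A B x \<otimes>\<^bsub>?S\<^esub> restricted_product A B y"
      by (simp only: xy)
  qed
  with bij have "?P \<cong> ?S" by (auto intro: is_isoI simp: iso_def)
  moreover have "group ?P"
    by (intro DirProd_group group_BijGroup group_map_Aut assms)
  ultimately show ?thesis by (rule group.iso_sym [rotated])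
qed

lemma sol_isos_apply:
  assumes "f \<in> sol_isos X R Y S" "x \<in> X" "y \<in> X"
  shows "S (f x, f y) = map_prod f f (R (x, y))"
  using assms by (auto simp: sol_isos_def)

lemma sol_isos_compose:
  assumes R: "R \<in> X \<times> X \<rightarrow> X \<times> X"
    and f: "f \<in> sol_isos X R Y S" and g: "g \<in> sol_isos Y S Z T"
  shows "compose X g f \<in> sol_isos X R Z T"
proof -
  have bij: "bij_betw f X Y" "bij_betw g Y Z" using f g by (auto simp: sol_isos_def bijections_def)
  have "T (g (f x), g (f y)) = map_prod (compose X g f) (compose X g f) (R (x, y))"
    if "x \<in> X" "y \<in> X" for x y
  proof -
    have "R (x, y) \<in> X \<times> X" using R that by blast
    moreover have "f x \<in> Y" "f y \<in> Y" using bij that by (auto dest: bij_betwE)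
    ultimately show ?thesis
      using sol_isos_apply [OF f that] sol_isos_apply [OF g, of "f x" "f y"]
      by (auto simp: compose_def map_prod_def split_beta)
  qed
  then show ?thesis
    using bij_betw_compose [OF bij] by (auto simp: sol_isos_def bijections_def compose_def)
qed

lemma sol_isos_inverse:
  assumes R: "R \<in> X \<times> X \<rightarrow> X \<times> X" and f: "f \<in> sol_isos X R Y S"
  shows "restrict (inv_into X f) Y \<in> sol_isos Y S X R"
proof -
  have bij: "bij_betw f X Y" using f by (auto simp: sol_isos_def bijections_def)
  then have inj: "inj_on f X" and Y: "Y = f ` X" by (auto simp: bij_betw_def)
  have "map_prod (restrict (inv_into X f) Y) (restrict (inv_into X f) Y) (S (f x, f y)) = R (x, y)"
    if "x \<in> X" "y \<in> X" for x y
  proof -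
    have "R (x, y) \<in> X \<times> X" using R that by blast
    then show ?thesis
      using sol_isos_apply [OF f that] inj Y by (cases "R (x, y)") simp
  qed
  then have "\<forall>p\<in>Y \<times> Y. (map_prod (restrict (inv_into X f) Y) (restrict (inv_into X f) Y) \<circ> S) p =
      (R \<circ> map_prod (restrict (inv_into X f) Y) (restrict (inv_into X f) Y)) p"
    using inj by (auto simp: Y)
  moreover have "bij_betw (restrict (inv_into X f) Y) Y X"
    using bij_betw_inv_into [OF bij] by (simp cong: bij_betw_cong)
  ultimately show ?thesis by (simp add: sol_isos_def bijections_def)
qed

text \<open>The isomorphism is the conjugation \<open>f \<mapsto> \<phi> \<circ> f \<circ> \<phi>\<inverse>\<close>, with inverse \<open>f \<mapsto> \<phi>\<inverse> \<circ> f \<circ> \<phi>\<close>.\<close>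

lemma sol_Aut_iso_if_isomorphic:
  assumes R: "R \<in> X \<times> X \<rightarrow> X \<times> X" and S: "S \<in> Y \<times> Y \<rightarrow> Y \<times> Y"
    and \<phi>: "\<phi> \<in> sol_isos X R Y S"
  shows "sol_Aut X R \<cong> sol_Aut Y S"
proof -
  define \<psi> where "\<psi> = restrict (inv_into X \<phi>) Y"
  have \<psi>: "\<psi> \<in> sol_isos Y S X R" unfolding \<psi>_def using R \<phi> by (rule sol_isos_inverse)
  have bij: "bij_betw \<phi> X Y" using \<phi> by (simp add: sol_isos_def bijections_def)
  have \<phi>Y: "\<phi> x \<in> Y" and \<psi>\<phi>: "\<psi> (\<phi> x) = x" if "x \<in> X" for x
    using bij that by (auto simp: \<psi>_def bij_betw_inv_into_left dest: bij_betwE)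
  have \<psi>X: "\<psi> y \<in> X" and \<phi>\<psi>: "\<phi> (\<psi> y) = y" if "y \<in> Y" for y
    using bij that by (auto simp: \<psi>_def bij_betw_inv_into_right inv_into_into bij_betw_def)
  have self_map: "f \<in> extensional X" "\<And>x. x \<in> X \<Longrightarrow> f x \<in> X"
    if "f \<in> sol_isos X R X R" for f and X :: "'z set" and R
    using that by (auto simp: sol_isos_def bijections_def dest: bij_betwE)
  define c where "c f = compose Y (compose X \<phi> f) \<psi>" for f
  define d where "d f = compose X (compose Y \<psi> f) \<phi>" for f
  have c: "c f \<in> sol_isos Y S Y S" if "f \<in> sol_isos X R X R" for f
    unfolding c_def using R S \<phi> \<psi> that by (blast intro: sol_isos_compose)
  have d: "d f \<in> sol_isos X R X R" if "f \<in> sol_isos Y S Y S" for f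
    unfolding d_def using R S \<phi> \<psi> that by (blast intro: sol_isos_compose)
  have "bij_betw c (sol_isos X R X R) (sol_isos Y S Y S)"
  proof (rule bij_betw_byWitness [where f' = d])
    show "\<forall>f\<in>sol_isos X R X R. d (c f) = f"
    proof
      fix f assume f: "f \<in> sol_isos X R X R"
      show "d (c f) = f"
        by (rule extensionalityI [OF _ self_map(1) [OF f]])
          (simp_all add: c_def d_def compose_def \<phi>Y \<psi>\<phi> self_map(2) [OF f])
    qed
    show "\<forall>f\<in>sol_isos Y S Y S. c (d f) = f"
    proof
      fix f assume f: "f \<in> sol_isos Y S Y S"
      show "c (d f) = f"
        by (rule extensionalityI [OF _ self_map(1) [OF f]])
          (simp_all add: c_def d_def compose_def \<psi>X \<phi>\<psi> self_map(2) [OF f])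
    qed
  qed (use c d in auto)
  moreover have "c (compose X f g) = compose Y (c f) (c g)"
    if "f \<in> sol_isos X R X R" "g \<in> sol_isos X R X R" for f g
    by (rule extensionalityI [where A = Y])
      (simp_all add: c_def compose_def \<psi>X \<psi>\<phi> \<phi>Y self_map(2) [OF that(1)] self_map(2) [OF that(2)])
  then have "c \<in> hom (sol_Aut X R) (sol_Aut Y S)"
    using c by (intro homI) (simp_all add: carrier_sol_Aut mult_sol_Aut sol_isos_compose [OF R])
  ultimately have "c \<in> iso (sol_Aut X R) (sol_Aut Y S)"
    by (simp add: iso_def carrier_sol_Aut)
  then show ?thesis by (rule is_isoI)
qed

section \<open>Classification\<close>

theorem theorem2p20:
  fixes X :: "'x set" and R :: "'x \<times> 'x \<Rightarrow> 'x \<times> 'x"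
  assumes "X \<noteq> {}"
    and "fs_solution X R"
    and "(fst \<circ> R) ` (X \<times> X) = X"
  shows
    "(\<exists>(A :: 'x set) (B :: 'x set) \<omega>.
        A \<noteq> {} \<and> B \<noteq> {} \<and> \<omega> \<in> B \<rightarrow> B \<and>
        fs_solution (A \<times> B) (R_omega \<omega>) \<and>
        (\<exists>\<phi>. \<phi> \<in> sol_isos X R (A \<times> B) (R_omega \<omega>)))
     \<and>
     (\<forall>(A :: 'a set) (B :: 'b set) (C :: 'c set) (D :: 'd set) \<omega> \<omega>'.
        A \<noteq> {} \<and> B \<noteq> {} \<and> \<omega> \<in> B \<rightarrow> B \<and> C \<noteq> {} \<and> D \<noteq> {} \<and> \<omega>' \<in> D \<rightarrow> D \<longrightarrow>
        (\<exists>F. bij_betw F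
               (sol_isos (A \<times> B) (R_omega \<omega>) (C \<times> D) (R_omega \<omega>'))
               {(\<sigma>1, \<sigma>2). \<sigma>1 \<in> bijections A C \<and> \<sigma>2 \<in> bijections B D \<and>
                  (\<forall>d \<in> D. \<omega>' d = (\<sigma>2 \<circ> \<omega> \<circ> inv_into B \<sigma>2) d)}))
     \<and>
     (\<forall>(A :: 'e set) (B :: 'f set) \<omega>.
        A \<noteq> {} \<and> B \<noteq> {} \<and> \<omega> \<in> B \<rightarrow> B \<and>
        (\<exists>\<phi>. \<phi> \<in> sol_isos X R (A \<times> B) (R_omega \<omega>)) \<longrightarrow>
        sol_Aut X R \<cong> sol_Aut (A \<times> B) (R_omega \<omega>) \<and>
        sol_Aut (A \<times> B) (R_omega \<omega>) \<cong> BijGroup A \<times>\<times> map_Aut B \<omega>)"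
proof (intro conjI allI impI)
  obtain A B :: "'x set" and \<omega> \<phi>
    where "A \<noteq> {}" "B \<noteq> {}" "\<omega> \<in> B \<rightarrow> B" "\<phi> \<in> sol_isos X R (A \<times> B) (R_omega \<omega>)"
    using assms by (rule surjective_solution_iso_R_omega)
  moreover from \<open>\<omega> \<in> B \<rightarrow> B\<close> have "fs_solution (A \<times> B) (R_omega \<omega>)"
    by (rule fs_solution_R_omega)
  ultimately show "\<exists>(A :: 'x set) (B :: 'x set) \<omega>.
      A \<noteq> {} \<and> B \<noteq> {} \<and> \<omega> \<in> B \<rightarrow> B \<and>
      fs_solution (A \<times> B) (R_omega \<omega>) \<and>
      (\<exists>\<phi>. \<phi> \<in> sol_isos X R (A \<times> B) (R_omega \<omega>))"
    by (intro exI conjI)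
next
  fix A :: "'a set" and B :: "'b set" and C :: "'c set" and D :: "'d set" and \<omega> \<omega>'
  assume *: "A \<noteq> {} \<and> B \<noteq> {} \<and> \<omega> \<in> B \<rightarrow> B \<and> C \<noteq> {} \<and> D \<noteq> {} \<and> \<omega>' \<in> D \<rightarrow> D"
  then have "bij_betw (restricted_product A B) (bijections A C \<times> intertwiners B \<omega> D \<omega>')
      (sol_isos (A \<times> B) (R_omega \<omega>) (C \<times> D) (R_omega \<omega>'))"
    by (intro bij_betw_restricted_product) auto
  note bij = bij_betw_inv_into [OF this]
  have pairs: "bijections A C \<times> intertwiners B \<omega> D \<omega>' =
      {(\<sigma>1, \<sigma>2). \<sigma>1 \<in> bijections A C \<and> \<sigma>2 \<in> bijections B D \<and>
        (\<forall>d \<in> D. \<omega>' d = (\<sigma>2 \<circ> \<omega> \<circ> inv_into B \<sigma>2) d)}"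
    using * by (auto simp: intertwiners_conjugation)
  show "\<exists>F. bij_betw F
      (sol_isos (A \<times> B) (R_omega \<omega>) (C \<times> D) (R_omega \<omega>'))
      {(\<sigma>1, \<sigma>2). \<sigma>1 \<in> bijections A C \<and> \<sigma>2 \<in> bijections B D \<and>
        (\<forall>d \<in> D. \<omega>' d = (\<sigma>2 \<circ> \<omega> \<circ> inv_into B \<sigma>2) d)}"
    unfolding pairs [symmetric] by (rule exI, rule bij)
next
  fix A :: "'e set" and B :: "'f set" and \<omega>
  assume *: "A \<noteq> {} \<and> B \<noteq> {} \<and> \<omega> \<in> B \<rightarrow> B \<and>
    (\<exists>\<phi>. \<phi> \<in> sol_isos X R (A \<times> B) (R_omega \<omega>))"
  then have "R_omega \<omega> \<in> (A \<times> B) \<times> (A \<times> B) \<rightarrow> (A \<times> B) \<times> (A \<times> B)"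
    by (auto simp: R_omega_def)
  moreover have "R \<in> X \<times> X \<rightarrow> X \<times> X" using assms(2) by (simp add: fs_solution_def)
  ultimately show "sol_Aut X R \<cong> sol_Aut (A \<times> B) (R_omega \<omega>)"
    using * sol_Aut_iso_if_isomorphic by blast
  show "sol_Aut (A \<times> B) (R_omega \<omega>) \<cong> BijGroup A \<times>\<times> map_Aut B \<omega>"
    using * by (intro sol_Aut_R_omega_iso) auto
qed

end
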